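(* Let $k\geq 2$ be an integer and let $D$ be an oriented graph with $\tilde{\delta}^{0}(D)\geq (2k+1)/3$. Then $D$ contains either an anti-directed path of length at least $k+1$ or an anti-directed cycle of length at least $k+1$.
   Context: All digraphs are finite, without loops or parallel arcs. An oriented graph is a digraph with at most one arc between any two distinct vertices. For a digraph $D$ and a vertex $v$, $d^{+}_{D}(v)$ and $d^{-}_{D}(v)$ denote the out-degree and in-degree of $v$. The minimum pseudo-semi-degree of $D$ is $\tilde{\delta}^{0}(D)=\min\{d^{+}_{D}(v),d^{-}_{D}(v) : v\in V(D) \text{ with } d^{+}_{D}(v)>0 \text{ or } d^{-}_{D}(v)>0\}$ (so vertices incident to no arc are ignored; $\tilde{\delta}^{0}(D)=0$ iff $D$ has no arcs). An anti-directed path of length $\ell$ is a sequence of $\ell+1$ distinct vertices $v_0,v_1,\dots,v_\ell$ such that each consecutive pair is joined by an arc and consecutive arcs have opposite orientations, i.e. $v_0\to v_1\leftarrow v_2\to\cdots$ or $v_0\leftarrow v_1\to v_2\leftarrow\cdots$. An anti-directed cycle of length $\ell$ is a cycle on $\ell$ distinct vertices $u_1,\dots,u_\ell$ (with $u_i$ adjacent to $u_{i+1}$, indices mod $\ell$) in which any two consecutive arcs have opposite orientations, i.e. either every $u_i$ with $i$ odd or every $u_i$ with $i$ even dominates both $u_{i-1}$ and $u_{i+1}$. *)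

theory Defs
  imports Complex_Main "Graph_Theory.Digraph"
begin

locale oriented_graph = digraph +
  assumes no_antiparallel: "u \<rightarrow>\<^bsub>G\<^esub> v \<Longrightarrow> \<not> v \<rightarrow>\<^bsub>G\<^esub> u"

definition positive_semi_degrees :: "('a, 'b) pre_digraph \<Rightarrow> nat set" where
  "positive_semi_degrees G =
     {out_degree G v | v. v \<in> verts G \<and> out_degree G v > 0} \<union>
     {in_degree G v | v. v \<in> verts G \<and> in_degree G v > 0}"

text \<open>
  Each of the two degrees of a vertex is taken into account exactly if it is positive: an
  out-degree (in-degree) equal to 0 is ignored even if the vertex has ingoing (outgoing) arcs.
  This is what makes the parameter vanish only for arcless digraphs (see
  \<open>min_pseudo_semi_degree_eq_0_iff\<close>). Keeping the zero degrees of vertices that are incident to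
  some arc gives the same value whenever that variant is positive
  (see \<open>min_pseudo_semi_degree_eq_Min\<close>).
\<close>

definition min_pseudo_semi_degree :: "('a, 'b) pre_digraph \<Rightarrow> nat" where
  "min_pseudo_semi_degree G = (if arcs G = {} then 0 else Min (positive_semi_degrees G))"

text \<open>
  Paths and cycles are given by their vertex lists, indexed from 0; a path of length \<open>l\<close> has
  \<open>l + 1\<close> vertices. The parameter \<open>r\<close> is the parity of the positions of the vertices that
  dominate their neighbours.
\<close>

definition antidirected_path :: "('a, 'b) pre_digraph \<Rightarrow> nat \<Rightarrow> 'a list \<Rightarrow> bool" where
  "antidirected_path G l p \<longleftrightarrow>
     length p = l + 1 \<and> distinct p \<and> set p \<subseteq> verts G \<and>
     (\<exists>r \<in> {0, 1}. \<forall>i < l.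
        if i mod 2 = r then p ! i \<rightarrow>\<^bsub>G\<^esub> p ! (i + 1) else p ! (i + 1) \<rightarrow>\<^bsub>G\<^esub> p ! i)"

text \<open>
  Evenness of the length is forced by the alternation of the arcs all the way round; it has to be
  explicit because for odd \<open>l\<close> and \<open>r = 1\<close> the last clause says nothing about the pair
  formed by the last and the first vertex.
\<close>

definition antidirected_cycle :: "('a, 'b) pre_digraph \<Rightarrow> nat \<Rightarrow> 'a list \<Rightarrow> bool" where
  "antidirected_cycle G l c \<longleftrightarrow>
     3 \<le> l \<and> even l \<and> length c = l \<and> distinct c \<and> set c \<subseteq> verts G \<and>
     (\<exists>r \<in> {0, 1}. \<forall>i < l. i mod 2 = r \<longrightarrow>
        c ! i \<rightarrow>\<^bsub>G\<^esub> c ! ((i + 1) mod l) \<and> c ! i \<rightarrow>\<^bsub>G\<^esub> c ! ((i + l - 1) mod l))"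

lemma (in fin_digraph) finite_positive_semi_degrees: "finite (positive_semi_degrees G)"
  unfolding positive_semi_degrees_def by simp

lemma (in fin_digraph) positive_semi_degrees_nonempty:
  assumes "arcs G \<noteq> {}"
  shows "positive_semi_degrees G \<noteq> {}"
proof -
  obtain e where e: "e \<in> arcs G" using assms by blast
  then have "e \<in> out_arcs G (tail G e)" by simp
  then have "out_degree G (tail G e) > 0"
    unfolding out_degree_def using finite_out_arcs card_gt_0_iff by blast
  moreover have "tail G e \<in> verts G" using e by simp
  ultimately show ?thesis unfolding positive_semi_degrees_def by blast
qed

lemma (in fin_digraph) min_pseudo_semi_degree_eq_0_iff:
  "min_pseudo_semi_degree G = 0 \<longleftrightarrow> arcs G = {}"
proof (cases "arcs G = {}")
  case False
  then have "Min (positive_semi_degrees G) \<in> positive_semi_degrees G"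
    using Min_in finite_positive_semi_degrees positive_semi_degrees_nonempty by blast
  then have "Min (positive_semi_degrees G) > 0"
    unfolding positive_semi_degrees_def by auto
  then show ?thesis using False by (simp add: min_pseudo_semi_degree_def)
qed (simp add: min_pseudo_semi_degree_def)

lemma (in fin_digraph) min_pseudo_semi_degree_eq_Min:
  defines "S \<equiv> \<Union>v \<in> {v \<in> verts G. out_degree G v > 0 \<or> in_degree G v > 0}.
                 {out_degree G v, in_degree G v}"
  assumes "arcs G \<noteq> {}" and pos: "Min S > 0"
  shows "min_pseudo_semi_degree G = Min S"
proof -
  have fin: "finite S" unfolding S_def by simp
  have sub: "positive_semi_degrees G \<subseteq> S"
    unfolding positive_semi_degrees_def S_def by blast
  have "S \<noteq> {}" using positive_semi_degrees_nonempty[OF assms(2)] sub by blast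
  then have all: "\<forall>s \<in> S. s > 0" using pos fin by simp
  have "s \<in> positive_semi_degrees G" if s: "s \<in> S" for s
  proof -
    have "s > 0" using all s by blast
    then show ?thesis using s unfolding S_def positive_semi_degrees_def by blast
  qed
  then have "S = positive_semi_degrees G" using sub by blast
  then show ?thesis using assms(2) by (simp add: min_pseudo_semi_degree_def)
qed

end

theory Submission
  imports Defs
begin

text \<open>
  Consider an anti-directed path with the maximum number \<open>L \<le> k + 1\<close> of vertices. The first
  vertex \<open>h\<close> of such a path, with its role, has all its neighbours on the path: in the matching
  role, where they allow a rotation, or in the wrong role. As the graph is oriented, the rotations
  with a fixed last vertex yield some end with few neighbours in the wrong role, so an end with
  the maximum number of neighbours in the matching role has many of them.

  If \<open>L\<close> is even, doing this at both ends forces a Hamiltonian cycle on the path. It is one of the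
  required cycles unless \<open>L \<le> k\<close>, in which case a vertex of the cycle can be put into the opposite
  role and joined to two vertices outside, giving a longer path. If \<open>L\<close> is odd, many rotations at
  both ends produce many vertices whose deletion leaves a Hamiltonian cycle; no vertex of the path
  has an arc to such a vertex in the wrong role, and this contradicts the degree condition.
\<close>

section \<open>Out-degrees in an asymmetric relation\<close>

text \<open>Each unordered pair carries at most one related pair, so the average out-degree in
  \<open>Y\<close> is at most \<open>(card Y - 1) / 2\<close>. If no element lies below this value,
  all attain it; this equality case later yields a strict bound at a prescribed vertex.\<close>

lemma asym_out_degree_cases:
  assumes fin: "finite Y" and asym: "\<And>y z. r y z \<Longrightarrow> \<not> r z y"
  shows "(\<exists>y\<in>Y. 2 * card {z\<in>Y. r y z} + 1 < card Y) \<or>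
         (\<forall>y\<in>Y. 2 * card {z\<in>Y. r y z} + 1 = card Y)"
proof -
  have total: "2 * (\<Sum>y\<in>Y. card {z\<in>Y. r y z}) + card Y \<le> card Y * card Y"
    using fin
  proof induction
    case (insert a Y)
    have irrefl: "\<not> r y y" for y using asym by blast
    have "{z\<in>insert a Y. r y z} = (if r y a then insert a {z\<in>Y. r y z} else {z\<in>Y. r y z})" for y
      by auto
    then have step: "card {z\<in>insert a Y. r y z} = card {z\<in>Y. r y z} + (if r y a then 1 else 0)" for y
      using insert.hyps by simp
    have "(\<Sum>y\<in>Y. if r y a then 1 else 0) = card {y\<in>Y. r y a}"
      using insert.hyps by (simp add: sum.If_cases Int_def)
    then have "(\<Sum>y\<in>insert a Y. card {z\<in>Y. r y z} + (if r y a then 1 else 0)) =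
        card {z\<in>Y. r a z} + (\<Sum>y\<in>Y. card {z\<in>Y. r y z}) + card {y\<in>Y. r y a}"
      using insert.hyps irrefl by (simp add: sum.distrib)
    then have "(\<Sum>y\<in>insert a Y. card {z\<in>insert a Y. r y z}) =
        card {z\<in>Y. r a z} + (\<Sum>y\<in>Y. card {z\<in>Y. r y z}) + card {y\<in>Y. r y a}"
      by (simp only: step)
    moreover have "card {z\<in>Y. r a z} + card {y\<in>Y. r y a} \<le> card Y"
    proof -
      have "card {z\<in>Y. r a z} + card {y\<in>Y. r y a} = card ({z\<in>Y. r a z} \<union> {y\<in>Y. r y a})"
        using insert.hyps asym by (subst card_Un_disjoint) auto
      also have "\<dots> \<le> card Y" using insert.hyps by (intro card_mono) auto
      finally show ?thesis .
    qed
    ultimately have "2 * (\<Sum>y\<in>insert a Y. card {z\<in>insert a Y. r y z}) \<le>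
        2 * card Y + 2 * (\<Sum>y\<in>Y. card {z\<in>Y. r y z})"
      by linarith
    then show ?case
      using insert.IH unfolding card_insert_disjoint[OF insert.hyps] by simp
  qed simp
  show ?thesis
  proof (rule ccontr)
    assume neg: "\<not> ?thesis"
    then obtain y0 where y0: "y0 \<in> Y" "2 * card {z\<in>Y. r y0 z} + 1 \<noteq> card Y" by blast
    have ge: "\<And>y. y \<in> Y \<Longrightarrow> card Y \<le> 2 * card {z\<in>Y. r y z} + 1" using neg not_less by blast
    have "card Y < 2 * card {z\<in>Y. r y0 z} + 1" using ge[OF y0(1)] y0(2) by linarith
    then have "(\<Sum>y\<in>Y. card Y) < (\<Sum>y\<in>Y. 2 * card {z\<in>Y. r y z} + 1)"
      using fin y0(1) ge by (intro sum_strict_mono_ex1) blast+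
    also have "\<dots> = 2 * (\<Sum>y\<in>Y. card {z\<in>Y. r y z}) + card Y"
      by (simp add: sum.distrib sum_distrib_left del: One_nat_def)
    finally show False using total by simp
  qed
qed

section \<open>Tagged vertices: paths, cycles and rotations\<close>

text \<open>
  A vertex is used by an anti-directed path either as a dominating vertex, tagged \<open>True\<close>, or as
  a dominated vertex, tagged \<open>False\<close>. With the tags, anti-directed paths become ordinary paths of
  an undirected bipartite graph in which no two vertices have the same first component.
\<close>

definition flip :: "'a \<times> bool \<Rightarrow> 'a \<times> bool" where
  "flip g = (fst g, \<not> snd g)"

lemma fst_flip [simp]: "fst (flip g) = fst g"
  and snd_flip [simp]: "snd (flip g) \<longleftrightarrow> \<not> snd g"
  and flip_flip [simp]: "flip (flip g) = g"
  by (auto simp: flip_def)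

lemma eq_or_eq_flip: "fst g = fst h \<Longrightarrow> g = h \<or> g = flip h"
  by (auto simp: prod_eq_iff flip_def)

text \<open>\<open>adj_asym\<close> says that there are no antiparallel arcs: its two adjacencies
  stand for opposite arcs between the same two vertices, and \<open>g = h\<close> excludes loops.
  The degree bound assumes a neighbour because the pseudo-semi-degree ignores zero degrees.\<close>

locale signed_graph =
  fixes adj :: "'a \<times> bool \<Rightarrow> 'a \<times> bool \<Rightarrow> bool" and d :: nat
  assumes adj_sym: "adj g h \<Longrightarrow> adj h g"
    and adj_snd: "adj g h \<Longrightarrow> snd h \<longleftrightarrow> \<not> snd g"
    and adj_asym: "adj g (flip h) \<Longrightarrow> \<not> adj h (flip g)"
    and adj_finite: "finite {h. adj g h}"
    and adj_degree: "adj g h \<Longrightarrow> d \<le> card {h. adj g h}"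
begin

definition path :: "('a \<times> bool) list \<Rightarrow> bool" where
  "path p \<longleftrightarrow> successively adj p \<and> distinct (map fst p)"

definition cycle :: "('a \<times> bool) list \<Rightarrow> bool" where
  "cycle c \<longleftrightarrow> path c \<and> c \<noteq> [] \<and> adj (last c) (hd c)"

definition nbrs_in :: "('a \<times> bool) set \<Rightarrow> 'a \<times> bool \<Rightarrow> ('a \<times> bool) set" where
  "nbrs_in M h = {g \<in> M. adj h g}"

definition flip_nbrs_in :: "('a \<times> bool) set \<Rightarrow> 'a \<times> bool \<Rightarrow> ('a \<times> bool) set" where
  "flip_nbrs_in M h = {g \<in> M. adj h (flip g)}"

text \<open>The new first vertices obtained from \<open>p\<close> by one rotation at its first vertex.\<close>

definition rotation_ends :: "('a \<times> bool) list \<Rightarrow> ('a \<times> bool) set" where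
  "rotation_ends p = (!) p ` {i. Suc i < length p \<and> adj (hd p) (p ! Suc i)}"

lemma adj_commute: "adj g h \<longleftrightarrow> adj h g"
  using adj_sym by blast

lemma not_adj_self: "\<not> adj g g"
  using adj_snd by blast

lemma adj_fst_neq: "adj g h \<Longrightarrow> fst g \<noteq> fst h"
  using eq_or_eq_flip[of h g] not_adj_self adj_asym by metis

lemma successively_adj_rev: "successively adj (rev p) \<longleftrightarrow> successively adj p"
proof -
  have "(\<lambda>g h. adj h g) = adj" using adj_commute by blast
  then show ?thesis by (simp only: successively_rev)
qed

lemma path_rev [simp]: "path (rev p) \<longleftrightarrow> path p"
  by (simp only: path_def successively_adj_rev rev_map[symmetric] distinct_rev)

lemma path_distinct: "path p \<Longrightarrow> distinct p"
  by (simp add: path_def distinct_map)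

lemma path_inj_on_fst: "path p \<Longrightarrow> inj_on fst (set p)"
  by (simp add: path_def distinct_map)

lemma path_card: "path p \<Longrightarrow> card (set p) = length p"
  by (simp add: path_distinct distinct_card)

lemma path_snd_nth:
  assumes "path p" "i < length p"
  shows "snd (p ! i) \<longleftrightarrow> (snd (hd p) \<longleftrightarrow> even i)"
  using assms(2)
proof (induction i)
  case 0
  then show ?case by (simp add: hd_conv_nth)
next
  case (Suc i)
  have "adj (p ! i) (p ! Suc i)"
    using assms(1) Suc.prems by (simp add: path_def successively_nth)
  then show ?case using adj_snd Suc by simp
qed

text \<open>Both counts need a joint induction, since dropping the first vertex exchanges the two
  tag classes.\<close>

lemma path_sign_count:
  assumes "successively adj p" "distinct p" "p \<noteq> []"
  shows "card {g \<in> set p. snd g = snd (hd p)} = (length p + 1) div 2"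
    and "card {g \<in> set p. snd g \<noteq> snd (hd p)} = length p div 2"
  using assms
proof (induction p rule: induct_list012)
  case (3 x y p)
  {
    case 1
    have "snd y \<longleftrightarrow> \<not> snd x" using 1 adj_snd by simp
    then have "{g \<in> set (x # y # p). snd g = snd (hd (x # y # p))} =
      insert x {g \<in> set (y # p). snd g \<noteq> snd (hd (y # p))}" by auto
    then show ?case using 1 3(4) by simp
  next
    case 2
    have "snd y \<longleftrightarrow> \<not> snd x" using 2 adj_snd by simp
    then have "{g \<in> set (x # y # p). snd g \<noteq> snd (hd (x # y # p))} =
      {g \<in> set (y # p). snd g = snd (hd (y # p))}" by auto
    then show ?case using 2 3(3) by simp
  }
qed (auto simp: Collect_conv_if conj_commute)

lemma path_sign_card_even:
  assumes "path p" "length p = 2 * t" "t > 0"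
  shows "card {g \<in> set p. snd g = s} = t"
proof -
  have "p \<noteq> []" using assms by auto
  then have c: "card {g \<in> set p. snd g = snd (hd p)} = (length p + 1) div 2"
    "card {g \<in> set p. snd g \<noteq> snd (hd p)} = length p div 2"
    using path_sign_count assms(1) path_distinct by (auto simp: path_def)
  have "s \<noteq> snd (hd p) \<Longrightarrow> {g \<in> set p. snd g = s} = {g \<in> set p. snd g \<noteq> snd (hd p)}"
    by auto
  then show ?thesis using c assms(2) by (cases "s = snd (hd p)") simp_all
qed

lemma path_sign_card_odd:
  assumes "path p" "length p = 2 * t + 1"
  shows "card {g \<in> set p. snd g = s} = (if s = snd (hd p) then t + 1 else t)"
proof -
  have "p \<noteq> []" using assms by auto
  then have c: "card {g \<in> set p. snd g = snd (hd p)} = (length p + 1) div 2"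
    "card {g \<in> set p. snd g \<noteq> snd (hd p)} = length p div 2"
    using path_sign_count assms(1) path_distinct by (auto simp: path_def)
  have "s \<noteq> snd (hd p) \<Longrightarrow> {g \<in> set p. snd g = s} = {g \<in> set p. snd g \<noteq> snd (hd p)}"
    by auto
  then show ?thesis using c assms(2) by (cases "s = snd (hd p)") simp_all
qed

text \<open>Taking predecessors on the path is a bijection from the neighbours of the first vertex
  to the rotation ends; the first vertex, which has no predecessor, is not its own
  neighbour.\<close>

lemma card_rotation_ends:
  assumes "path p"
  shows "card (rotation_ends p) = card (nbrs_in (set p) (hd p))"
proof -
  let ?I = "{i. Suc i < length p \<and> adj (hd p) (p ! Suc i)}"
  have dist: "distinct p" using assms by (rule path_distinct)
  have "nbrs_in (set p) (hd p) = (\<lambda>i. p ! Suc i) ` ?I"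
  proof (intro equalityI subsetI)
    fix g assume "g \<in> nbrs_in (set p) (hd p)"
    then obtain i where i: "i < length p" "g = p ! i" "adj (hd p) (p ! i)"
      by (auto simp: nbrs_in_def in_set_conv_nth)
    then have "i \<noteq> 0" using not_adj_self hd_conv_nth[of p] by (metis length_0_conv not_less0)
    then show "g \<in> (\<lambda>i. p ! Suc i) ` ?I" using i by (auto intro!: image_eqI[of _ _ "i - 1"])
  qed (auto simp: nbrs_in_def)
  moreover have "inj_on (\<lambda>i. p ! Suc i) ?I" "inj_on ((!) p) ?I"
    using dist by (auto simp: inj_on_def nth_eq_iff_index_eq)
  ultimately show ?thesis by (simp add: rotation_ends_def card_image)
qed

lemma rotation_endsE:
  assumes "e \<in> rotation_ends p"
  obtains as g bs where "p = as @ e # g # bs" "adj (hd p) g"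
proof -
  obtain i where i: "Suc i < length p" "adj (hd p) (p ! Suc i)" "e = p ! i"
    using assms by (auto simp: rotation_ends_def)
  have "p = take i p @ p ! i # drop (Suc i) p"
    using i by (intro id_take_nth_drop) simp
  also have "drop (Suc i) p = p ! Suc i # drop (Suc (Suc i)) p"
    using i by (simp add: Cons_nth_drop_Suc)
  finally show ?thesis using that i by blast
qed

text \<open>The initial segment ending in \<open>e\<close> is reversed, so that the old first vertex
  meets its neighbour \<open>g\<close>. The tags agree because \<open>e\<close> and the old first
  vertex are both adjacent to \<open>g\<close>.\<close>

lemma rotation_ends_path:
  assumes "path p" "e \<in> rotation_ends p"
  obtains q where "path q" "set q = set p" "length q = length p" "q \<noteq> []" "hd q = e" "last q = last p"
    "snd e = snd (hd p)"
proof -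
  obtain as g bs where p: "p = as @ e # g # bs" and g: "adj (hd p) g"
    using assms(2) by (rule rotation_endsE)
  have eg: "adj e g" using assms(1) by (auto simp: p path_def successively_append_iff)
  let ?q = "rev (as @ [e]) @ g # bs"
  have "hd p = hd (as @ [e])" by (simp add: p hd_append)
  then have "last (rev (as @ [e])) = hd p" by (simp only: last_rev)
  moreover have "successively adj (as @ [e])" "successively adj (g # bs)"
    using assms(1) by (auto simp: p path_def successively_append_iff successively_Cons)
  ultimately have "successively adj ?q"
    using g by (simp only: successively_append_iff successively_adj_rev) auto
  moreover have "distinct (map fst ?q)" using assms(1) by (auto simp: p path_def rev_map[symmetric])
  ultimately have "path ?q" by (simp add: path_def)
  moreover have "snd e = snd (hd p)" using eg g adj_snd by blast
  ultimately show ?thesis using that[of ?q] by (auto simp: p)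
qed

lemma rotation_ends_subset: "path p \<Longrightarrow> rotation_ends p \<subseteq> {g \<in> set p. snd g = snd (hd p)}"
proof
  fix e assume "path p" "e \<in> rotation_ends p"
  then obtain q where "set q = set p" "q \<noteq> []" "hd q = e" "snd e = snd (hd p)"
    by (rule rotation_ends_path)
  then show "e \<in> {g \<in> set p. snd g = snd (hd p)}" using hd_in_set by force
qed

text \<open>The second vertex is a neighbour of the first, and the rotation there is
  trivial.\<close>

lemma hd_in_rotation_ends:
  assumes "path p" "length p \<ge> 2"
  shows "hd p \<in> rotation_ends p"
proof -
  obtain x y q where "p = x # y # q" using assms(2) by (cases p; cases "tl p") auto
  then show ?thesis using assms(1)
    by (auto simp: rotation_ends_def path_def intro!: image_eqI[of _ _ 0])
qed

lemma last_notin_rotation_ends: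
  assumes "path p"
  shows "last p \<notin> rotation_ends p"
proof
  assume "last p \<in> rotation_ends p"
  then obtain as g bs where "p = as @ last p # g # bs" by (rule rotation_endsE)
  moreover from this have "last p = last (g # bs)" by (metis last_appendR last_ConsR list.distinct(1))
  ultimately show False
    using path_distinct[OF assms] by (metis distinct.simps(2) distinct_append last_in_set list.distinct(1))
qed

lemma cycle_rotate:
  assumes "cycle c" "y \<in> set c"
  obtains q where "cycle q" "set q = set c" "length q = length c" "hd q = y"
proof -
  obtain as bs where c: "c = as @ y # bs" using assms(2) by (meson split_list)
  have "cycle (y # bs @ as)"
  proof (cases "as = []")
    case False
    then show ?thesis using assms(1)
      by (auto simp: c cycle_def path_def successively_append_iff successively_Cons hd_append)
  qed (use assms(1) in \<open>simp add: c\<close>)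
  then show ?thesis using that[of "y # bs @ as"] by (auto simp: c)
qed

end

section \<open>Degrees at the ends of longest paths\<close>

locale bounded_signed_graph = signed_graph adj d
  for adj :: "'a \<times> bool \<Rightarrow> 'a \<times> bool \<Rightarrow> bool" and d :: nat +
  fixes L :: nat
  assumes path_length_le: "path p \<Longrightarrow> length p \<le> L"
    and two_le_bound: "2 \<le> L"
begin

lemma hd_nbrs_fst:
  assumes "path p" "length p = L" "adj (hd p) g"
  shows "fst g \<in> fst ` set p"
proof (rule ccontr)
  assume "fst g \<notin> fst ` set p"
  then have "path (g # p)"
    using assms adj_sym by (auto simp: path_def successively_Cons)
  then show False using path_length_le assms(2) by fastforce
qed

lemma hd_has_nbr:
  assumes "path p" "length p = L"
  obtains g where "adj (hd p) g"
proof -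
  obtain x y q where "p = x # y # q" using assms two_le_bound by (cases p; cases "tl p") auto
  then show ?thesis using assms(1) that[of y] by (simp add: path_def)
qed

text \<open>By maximality every neighbour of the first vertex sits at a vertex of the path, carrying
  either the tag used there or the opposite one.\<close>

lemma degree_le_nbrs:
  assumes "path p" "length p = L"
  shows "d \<le> card (nbrs_in (set p) (hd p)) + card (flip_nbrs_in (set p) (hd p))"
proof -
  obtain g0 where "adj (hd p) g0" using assms by (rule hd_has_nbr)
  then have "d \<le> card {g. adj (hd p) g}" by (rule adj_degree)
  also have "{g. adj (hd p) g} \<subseteq> nbrs_in (set p) (hd p) \<union> flip ` flip_nbrs_in (set p) (hd p)"
  proof
    fix g assume "g \<in> {g. adj (hd p) g}"
    then have g: "adj (hd p) g" by simp
    then obtain h where h: "h \<in> set p" "fst g = fst h" using hd_nbrs_fst assms by blast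
    then have "g = h \<or> g = flip h" by (intro eq_or_eq_flip)
    then show "g \<in> nbrs_in (set p) (hd p) \<union> flip ` flip_nbrs_in (set p) (hd p)"
      using g h by (auto simp: nbrs_in_def flip_nbrs_in_def)
  qed
  then have "card {g. adj (hd p) g} \<le> card (nbrs_in (set p) (hd p) \<union> flip ` flip_nbrs_in (set p) (hd p))"
    by (intro card_mono) (auto simp: nbrs_in_def flip_nbrs_in_def)
  also have "\<dots> \<le> card (nbrs_in (set p) (hd p)) + card (flip ` flip_nbrs_in (set p) (hd p))"
    by (rule card_Un_le)
  also have "card (flip ` flip_nbrs_in (set p) (hd p)) \<le> card (flip_nbrs_in (set p) (hd p))"
    by (intro card_image_le) (auto simp: flip_nbrs_in_def)
  finally show ?thesis by simp
qed

text \<open>The two roles of a vertex have disjoint neighbourhoods, which together do not fit into \<open>p\<close>.\<close>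

lemma flip_hd_nbr_outside:
  assumes "path p" "length p = L" "adj y (flip (hd p))" "L \<le> 2 * d"
  obtains w where "adj w (flip (hd p))" "fst w \<notin> fst ` set p"
proof (rule ccontr)
  let ?u = "hd p"
  assume neg: "\<not> thesis"
  let ?P = "fst ` {h. adj ?u h}" and ?Q = "fst ` {h. adj (flip ?u) h}"
  obtain g0 where "adj ?u g0" using assms(1,2) by (rule hd_has_nbr)
  then have "d \<le> card {h. adj ?u h}" by (rule adj_degree)
  moreover have "d \<le> card {h. adj (flip ?u) h}" using adj_sym[OF assms(3)] by (rule adj_degree)
  moreover have "inj_on fst {h. adj g h}" for g
    using adj_snd by (auto simp: inj_on_def prod_eq_iff)
  ultimately have ge: "d \<le> card ?P" "d \<le> card ?Q" by (simp_all add: card_image)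
  \<comment> \<open>A common vertex would have arcs both to and from \<open>fst ?u\<close>.\<close>
  have disj: "?P \<inter> ?Q = {}"
  proof (rule ccontr)
    assume "?P \<inter> ?Q \<noteq> {}"
    then obtain h g where hg: "adj ?u h" "adj (flip ?u) g" "fst h = fst g" by auto
    then have "h = flip g" using adj_snd[OF hg(1)] adj_snd[OF hg(2)] by (simp add: prod_eq_iff)
    then show False using hg adj_asym adj_sym by blast
  qed
  have inside: "fst w \<in> fst ` set p" if "adj w (flip ?u)" for w
    using neg \<open>\<And>w. adj w (flip ?u) \<Longrightarrow> fst w \<notin> fst ` set p \<Longrightarrow> thesis\<close> that by blast
  have "fst h \<in> fst ` set p - {fst ?u}" if "adj ?u h \<or> adj (flip ?u) h" for h
    using that inside[of h] hd_nbrs_fst[OF assms(1,2), of h] adj_sym[of "flip ?u" h] adj_fst_neq[of ?u h]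
      adj_fst_neq[of "flip ?u" h]
    by auto
  then have "?P \<union> ?Q \<subseteq> fst ` set p - {fst ?u}"
    by (intro Un_least image_subsetI) simp_all
  then have "card (?P \<union> ?Q) \<le> card (fst ` set p - {fst ?u})" by (intro card_mono) auto
  moreover have "card (?P \<union> ?Q) = card ?P + card ?Q"
    using disj adj_finite by (intro card_Un_disjoint) auto
  \<comment> \<open>Since \<open>fst ?u\<close> itself is excluded, fewer than \<open>L\<close>
    places remain for the at least \<open>2 * d\<close> vertices of the two neighbourhoods.\<close>
  moreover have "card (fst ` set p - {fst ?u}) < L"
  proof -
    have "p \<noteq> []" using assms(2) two_le_bound by auto
    then have "card (fst ` set p - {fst ?u}) < card (fst ` set p)" by (intro card_Diff1_less) auto
    then show ?thesis using assms(1,2) by (simp add: card_image path_inj_on_fst path_card)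
  qed
  ultimately show False using ge assms(4) by simp
qed

lemma flip_nbr_sign: "g \<in> flip_nbrs_in M y \<Longrightarrow> snd g = snd y"
  using adj_snd by (fastforce simp: flip_nbrs_in_def)

text \<open>Only the set of tagged vertices is fixed, so different paths on it can be compared;
  rotations preserve this set.\<close>

definition ends :: "('a \<times> bool) set \<Rightarrow> ('a \<times> bool) set" where
  "ends M = {hd p | p. path p \<and> length p = L \<and> set p = M}"

lemma endsE:
  assumes "h \<in> ends M"
  obtains p where "path p" "length p = L" "set p = M" "hd p = h" "p \<noteq> []"
  using assms two_le_bound by (fastforce simp: ends_def)

lemma ends_degree_le: "h \<in> ends M \<Longrightarrow> d \<le> card (nbrs_in M h) + card (flip_nbrs_in M h)"
  using degree_le_nbrs by (auto simp: ends_def)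

lemma rotation_ends_subset_ends:
  assumes "path p" "length p = L"
  shows "rotation_ends p \<subseteq> ends (set p)"
proof
  fix e assume "e \<in> rotation_ends p"
  with assms(1) obtain q where "path q" "set q = set p" "length q = length p" "e = hd q"
    by (rule rotation_ends_path) blast
  then show "e \<in> ends (set p)" using assms(2) unfolding ends_def by blast
qed

text \<open>
  The vertices of \<open>H\<close> cannot all have many neighbours in flipped vertices of \<open>H\<close>, since between
  two of them there is at most one arc.
\<close>

lemma ends_degree_bound:
  assumes fin: "finite M"
    and H: "H \<subseteq> ends M" "H \<subseteq> {g \<in> M. snd g = s}" "H \<noteq> {}"
    and Z: "Z \<subseteq> {g \<in> M. snd g = s}" "H \<inter> Z = {}" "\<And>y. y \<in> H \<Longrightarrow> flip_nbrs_in M y \<inter> Z = {}"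
    and a: "\<And>y. y \<in> H \<Longrightarrow> card (nbrs_in M y) \<le> a"
  shows "2 * d + 2 * card Z + card H + 1 \<le> 2 * a + 2 * card {g \<in> M. snd g = s}"
    and "y0 \<in> H \<Longrightarrow> card (nbrs_in M y0) < a \<Longrightarrow>
      2 * d + 2 * card Z + card H + 1 < 2 * a + 2 * card {g \<in> M. snd g = s}"
proof -
  let ?N = "{g \<in> M. snd g = s}"
  let ?out = "\<lambda>y. card {z\<in>H. adj y (flip z)}"
  have finH: "finite H" "finite Z" "finite ?N"
    using fin H Z by (auto intro: finite_subset)
  have bound: "2 * d + 2 * card Z + 2 * card H \<le> 2 * card (nbrs_in M y) + 2 * card ?N + 2 * ?out y"
    if y: "y \<in> H" for y
  proof -
    have "flip_nbrs_in M y \<subseteq> {z\<in>H. adj y (flip z)} \<union> (?N - (H \<union> Z))"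
    proof
      fix z assume z: "z \<in> flip_nbrs_in M y"
      then have "snd z = s" using flip_nbr_sign y H(2) by blast
      then show "z \<in> {z\<in>H. adj y (flip z)} \<union> (?N - (H \<union> Z))"
        using z Z(3)[OF y] by (auto simp: flip_nbrs_in_def)
    qed
    then have "card (flip_nbrs_in M y) \<le> card ({z\<in>H. adj y (flip z)} \<union> (?N - (H \<union> Z)))"
      using finH by (intro card_mono) auto
    also have "\<dots> \<le> ?out y + card (?N - (H \<union> Z))" by (rule card_Un_le)
    also have "card (?N - (H \<union> Z)) = card ?N - card (H \<union> Z)"
      using H Z finH by (intro card_Diff_subset) auto
    also have "card (H \<union> Z) = card H + card Z"
      using Z finH by (intro card_Un_disjoint) auto
    finally have "card (flip_nbrs_in M y) \<le> ?out y + (card ?N - (card H + card Z))" .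
    moreover have "card H + card Z \<le> card ?N"
      using H Z finH card_mono[of ?N "H \<union> Z"] by (auto simp: card_Un_disjoint)
    moreover have "d \<le> card (nbrs_in M y) + card (flip_nbrs_in M y)"
      using y H by (intro ends_degree_le) auto
    ultimately show ?thesis by simp
  qed
  \<comment> \<open>Averaging over \<open>H\<close> gives the weak bound. For the strict one, either
    some out-degree is below the average, or all are equal and \<open>y0\<close> itself, having
    fewer than \<open>a\<close> neighbours, provides the strictness.\<close>
  have cases: "(\<exists>y\<in>H. 2 * ?out y + 1 < card H) \<or> (\<forall>y\<in>H. 2 * ?out y + 1 = card H)"
    using finH adj_asym by (intro asym_out_degree_cases) auto
  then obtain y where "y \<in> H" "2 * ?out y + 1 \<le> card H"
    using H(3) by (metis (no_types, lifting) ex_in_conv le_eq_less_or_eq)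
  then show "2 * d + 2 * card Z + card H + 1 \<le> 2 * a + 2 * card ?N"
    using bound[of y] a[of y] by simp
  assume y0: "y0 \<in> H" "card (nbrs_in M y0) < a"
  from cases show "2 * d + 2 * card Z + card H + 1 < 2 * a + 2 * card ?N"
  proof
    assume "\<exists>y\<in>H. 2 * ?out y + 1 < card H"
    then obtain y where "y \<in> H" "2 * ?out y + 1 < card H" by blast
    then show ?thesis using bound[of y] a[of y] by simp
  next
    assume "\<forall>y\<in>H. 2 * ?out y + 1 = card H"
    then have "2 * ?out y0 + 1 = card H" using y0 by blast
    then show ?thesis using bound[of y0] y0 by simp
  qed
qed

text \<open>This is \<open>ends_degree_bound\<close> for the rotation ends with empty
  \<open>Z\<close>: their number equals the maximal neighbour count, which cancels one of its two
  occurrences on the right.\<close>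

lemma rotation_bound:
  assumes "path p" "length p = L"
    and max: "\<And>q. path q \<Longrightarrow> length q = L \<Longrightarrow> set q = set p \<Longrightarrow> last q = last p \<Longrightarrow>
      card (nbrs_in (set p) (hd q)) \<le> card (nbrs_in (set p) (hd p))"
  shows "2 * d + 1 \<le> card (nbrs_in (set p) (hd p)) + 2 * card {g \<in> set p. snd g = snd (hd p)}"
proof -
  let ?a = "card (nbrs_in (set p) (hd p))"
  have "2 * d + 2 * card ({} :: ('a \<times> bool) set) + card (rotation_ends p) + 1
      \<le> 2 * ?a + 2 * card {g \<in> set p. snd g = snd (hd p)}"
  proof (rule ends_degree_bound(1))
    show "rotation_ends p \<subseteq> ends (set p)" using assms by (intro rotation_ends_subset_ends)
    show "rotation_ends p \<subseteq> {g \<in> set p. snd g = snd (hd p)}"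
      using assms by (intro rotation_ends_subset)
    show "rotation_ends p \<noteq> {}" using hd_in_rotation_ends assms two_le_bound by fastforce
    fix y assume "y \<in> rotation_ends p"
    with assms(1) obtain q where "path q" "set q = set p" "length q = length p" "hd q = y"
      "last q = last p" by (rule rotation_ends_path)
    then show "card (nbrs_in (set p) y) \<le> ?a" using max[of q] assms(2) by simp
  qed auto
  then show ?thesis using card_rotation_ends[OF assms(1)] by simp
qed

lemma card_nbrs_in_le: "finite M \<Longrightarrow> card (nbrs_in M h) \<le> card M"
  by (intro card_mono) (auto simp: nbrs_in_def)

section \<open>Longest paths with an even number of vertices\<close>

text \<open>A path maximising the sum of the neighbour counts at its two ends is optimal at each end
  while the other is fixed, so \<open>rotation_bound\<close> applies to both. Without a Hamiltonian
  cycle, the rotation ends and the neighbours of the last vertex are disjoint subsets of one tag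
  class of size \<open>t\<close>, which is too small.\<close>

lemma even_hamiltonian_cycle:
  assumes p: "path p" "length p = L" and t: "L = 2 * t" "4 * t \<le> 3 * d + 1"
  obtains c where "cycle c" "set c = set p"
proof (rule ccontr)
  assume neg: "\<not> thesis"
  let ?P = "\<lambda>q. path q \<and> length q = L \<and> set q = set p"
  let ?f = "\<lambda>q. card (nbrs_in (set p) (hd q)) + card (nbrs_in (set p) (last q))"
  have "\<exists>q. ?P q \<and> (\<forall>r. ?P r \<longrightarrow> ?f r \<le> ?f q)"
    using p card_nbrs_in_le[of "set p"]
    by (intro ex_has_greatest_nat[where b = "Suc (2 * card (set p))" and k = p])
      (auto simp: mult_2 less_Suc_eq_le add_mono)
  then obtain q where q: "path q" "length q = L" "set q = set p"
    and max: "\<And>r. path r \<Longrightarrow> length r = L \<Longrightarrow> set r = set p \<Longrightarrow> ?f r \<le> ?f q" by blast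
  let ?a = "card (nbrs_in (set p) (hd q))" and ?b = "card (nbrs_in (set p) (last q))"
  have ne: "q \<noteq> []" and tpos: "t > 0" using q two_le_bound t by auto
  have signs: "card {g \<in> set p. snd g = s} = t" for s
    using path_sign_card_even[of q t s] q t tpos by simp
  have a: "2 * d + 1 \<le> ?a + 2 * t"
  proof -
    have "card (nbrs_in (set p) (hd r)) \<le> ?a"
      if "path r" "length r = L" "set r = set p" "last r = last q" for r
      using max[of r] that by simp
    then show ?thesis using rotation_bound[of q] q signs by simp
  qed
  have b: "2 * d + 1 \<le> ?b + 2 * t"
  proof -
    have "card (nbrs_in (set p) (hd r)) \<le> ?b"
      if "path r" "length r = L" "set r = set p" "last r = hd q" for r
      using max[of "rev r"] that by (simp add: hd_rev last_rev)
    then show ?thesis using rotation_bound[of "rev q"] q signs by (simp add: hd_rev last_rev)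
  qed
  \<comment> \<open>If the last vertex is adjacent to a rotation end \<open>e\<close>, reversing the
    part after \<open>e\<close> gives a cycle: \<open>e\<close> meets \<open>last q\<close>, and
    \<open>g\<close> meets \<open>hd q\<close>.\<close>
  have disj: "rotation_ends q \<inter> nbrs_in (set p) (last q) = {}"
  proof (rule ccontr)
    assume "rotation_ends q \<inter> nbrs_in (set p) (last q) \<noteq> {}"
    then obtain e where e: "e \<in> rotation_ends q" "adj (last q) e" by (auto simp: nbrs_in_def)
    from e(1) obtain as g bs where split: "q = as @ e # g # bs" and g: "adj (hd q) g"
      by (rule rotation_endsE)
    let ?c = "(as @ [e]) @ rev (g # bs)"
    have "successively adj (as @ [e])" "successively adj (rev (g # bs))"
      using q(1) unfolding successively_adj_rev
      by (auto simp: split path_def successively_append_iff successively_Cons)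
    moreover have "last (g # bs) = last q" "hd q = hd ?c" by (simp_all add: split hd_append)
    ultimately have "successively adj ?c"
      using e(2) adj_sym by (simp only: successively_append_iff hd_rev) auto
    moreover have "distinct (map fst ?c)" using q(1) by (auto simp: split path_def rev_map[symmetric])
    ultimately have "cycle ?c"
      using g adj_sym \<open>hd q = hd ?c\<close> by (auto simp: cycle_def path_def)
    moreover have "set ?c = set p" using q(3) by (auto simp: split)
    ultimately show False using neg that by blast
  qed
  have "snd (last q) \<longleftrightarrow> \<not> snd (hd q)"
    using path_snd_nth[OF q(1), of "length q - 1"] ne q t tpos by (simp add: last_conv_nth)
  then have "nbrs_in (set p) (last q) \<subseteq> {g \<in> set p. snd g = snd (hd q)}"
    by (auto simp: nbrs_in_def dest: adj_snd)
  then have "card (rotation_ends q \<union> nbrs_in (set p) (last q)) \<le> card {g \<in> set p. snd g = snd (hd q)}"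
    using rotation_ends_subset[OF q(1)] q(3) by (intro card_mono) auto
  then have "?a + ?b \<le> t"
    using disj signs card_rotation_ends[OF q(1)] q(3) rotation_ends_subset[OF q(1)]
    by (subst (asm) card_Un_disjoint) (auto simp: nbrs_in_def intro: finite_subset)
  \<comment> \<open>The three bounds give \<open>4 * d + 2 \<le> 5 * t\<close>, contrary to
    \<open>4 * t \<le> 3 * d + 1\<close>.\<close>
  then show False using a b t by simp
qed

lemma cycle_subset_ends:
  assumes "cycle c" "length c = L"
  shows "set c \<subseteq> ends (set c)"
proof
  fix y assume "y \<in> set c"
  with assms(1) obtain q where "cycle q" "set q = set c" "length q = length c" "y = hd q"
    by (rule cycle_rotate) blast
  then show "y \<in> ends (set c)" using assms(2) unfolding ends_def cycle_def by blast
qed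

text \<open>Let \<open>h\<close> have the most neighbours in its class, and let the cycle, cut open
  before \<open>h\<close>, end in \<open>y\<close>, \<open>z\<close>. Some \<open>u\<close> is both
  a rotation end and a flipped neighbour of \<open>y\<close>. Dropping \<open>u\<close> and
  \<open>z\<close> leaves a path starting at \<open>y\<close>, which is extended by
  \<open>flip u\<close> and two outside vertices \<open>w\<close>, \<open>x\<close>: three vertices
  replace two.\<close>

lemma even_cycle_impossible:
  assumes c: "cycle c" "length c = L" and t: "L = 2 * t" "4 * t + 1 \<le> 3 * d"
  shows False
proof -
  let ?M = "set c" and ?N = "{g \<in> set c. snd g}"
  have tpos: "t > 0" using t two_le_bound by simp
  have path_c: "path c" using c by (simp add: cycle_def)
  have N: "card ?N = t"
    using path_sign_card_even[OF path_c, of t True] c t tpos by simp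
  then obtain h0 where "h0 \<in> ?N" using tpos by (metis card.empty ex_in_conv less_numeral_extra(3))
  then have "\<exists>h. h \<in> ?N \<and> (\<forall>y. y \<in> ?N \<longrightarrow> card (nbrs_in ?M y) \<le> card (nbrs_in ?M h))"
    using card_nbrs_in_le by (intro ex_has_greatest_nat[where b = "Suc (card ?M)"])
      (auto simp: less_Suc_eq_le)
  then obtain h where h: "h \<in> ?M" "snd h"
    and max: "\<And>y. y \<in> ?M \<Longrightarrow> snd y \<Longrightarrow> card (nbrs_in ?M y) \<le> card (nbrs_in ?M h)" by blast
  obtain q where q: "cycle q" "set q = ?M" "length q = length c" "hd q = h"
    using cycle_rotate[OF c(1) h(1)] .
  have path_q: "path q" using q by (simp add: cycle_def)
  obtain q' y z where qyz: "q = q' @ [y, z]"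
  proof -
    have "q \<noteq> []" "butlast q \<noteq> []" using q c two_le_bound by (auto simp flip: length_greater_0_conv)
    then have "q = butlast (butlast q) @ [last (butlast q), last q]"
      by (metis append.assoc append_Cons append_Nil append_butlast_last_id)
    then show ?thesis using that by blast
  qed
  have "adj z h" using q by (auto simp: cycle_def qyz)
  moreover have yz: "adj y z" using path_q by (auto simp: path_def qyz successively_append_iff)
  ultimately have sgn: "snd y" "\<not> snd z" using h adj_snd by blast+
  have yM: "y \<in> ?M" using q(2) by (auto simp: qyz)
  have "d \<le> card (nbrs_in ?M y) + card (flip_nbrs_in ?M y)"
    using cycle_subset_ends[OF c] yM by (intro ends_degree_le) auto
  also have "card (nbrs_in ?M y) \<le> card (nbrs_in ?M h)" using max yM sgn by blast
  also have "\<dots> = card (rotation_ends q)" using card_rotation_ends[OF path_q] q by simp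
  finally have d_le: "d \<le> card (rotation_ends q) + card (flip_nbrs_in ?M y)" by simp
  have sub: "rotation_ends q \<subseteq> ?N" "flip_nbrs_in ?M y \<subseteq> ?N"
    using rotation_ends_subset[OF path_q] q h flip_nbr_sign[of _ ?M y] sgn
    by (auto simp: flip_nbrs_in_def)
  \<comment> \<open>Two subsets of a class of size \<open>t\<close> whose sizes sum to at least
    \<open>d > t\<close> must meet.\<close>
  have "rotation_ends q \<inter> flip_nbrs_in ?M y \<noteq> {}"
  proof
    assume "rotation_ends q \<inter> flip_nbrs_in ?M y = {}"
    then have "card (rotation_ends q) + card (flip_nbrs_in ?M y) =
        card (rotation_ends q \<union> flip_nbrs_in ?M y)"
      using sub by (intro card_Un_disjoint[symmetric]) (auto intro: finite_subset)
    also have "\<dots> \<le> card ?N" using sub by (intro card_mono) auto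
    finally show False using d_le N t by simp
  qed
  then obtain u where u: "u \<in> rotation_ends q" "u \<in> ?M" "adj y (flip u)" "snd u"
    using sub by (auto simp: flip_nbrs_in_def)
  from u(1) obtain as g bs where split: "q = as @ u # g # bs" and g: "adj (hd q) g"
    by (rule rotation_endsE)
  have "u \<noteq> y" using adj_fst_neq[OF u(3)] by auto
  have "bs \<noteq> []" using \<open>u \<noteq> y\<close> split qyz by auto
  then obtain bs' z' where bs: "bs = bs' @ [z']" by (meson rev_exhaust)
  then have split': "as @ u # g # bs' = q' @ [y]" "z' = z" using split qyz by auto
  let ?r = "g # bs'"
  have last_r: "last ?r = y" using split'(1) by (metis last_appendR last_ConsR last_snoc list.distinct(1))
  \<comment> \<open>This path runs from \<open>y\<close> back to \<open>g\<close>, jumps to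
    \<open>h\<close> if \<open>as\<close> is nonempty, and then stops just before
    \<open>u\<close>.\<close>
  let ?p = "rev ?r @ as"
  have hd_as: "as \<noteq> [] \<Longrightarrow> hd as = hd q" by (simp add: split)
  have "successively adj (rev ?r)" "successively adj as"
    using path_q unfolding successively_adj_rev
    by (auto simp: split bs path_def successively_append_iff successively_Cons)
  then have succ_p: "successively adj ?p"
    using adj_sym[OF g] hd_as
    by (cases "as = []") (simp_all only: successively_append_iff last_rev list.sel(1), simp_all)
  have hd_p: "hd ?p = y" using last_r by (auto simp: hd_append hd_rev split: if_splits)
  have sub_p: "set ?p \<subseteq> ?M" using q(2) by (auto simp: split bs)
  have dist: "distinct (map fst ?p)" "fst u \<notin> fst ` set ?p"
    using path_q by (auto simp: split bs path_def rev_map[symmetric])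
  obtain cu where cu: "cycle cu" "set cu = ?M" "length cu = length c" "hd cu = u"
    using cycle_rotate[OF c(1) u(2)] .
  obtain w where w: "adj w (flip u)" "fst w \<notin> fst ` ?M"
  proof -
    have "path cu" "length cu = L" "adj y (flip (hd cu))" "L \<le> 2 * d"
      using cu c u t by (auto simp: cycle_def)
    then show ?thesis using flip_hd_nbr_outside[of cu y] cu that by metis
  qed
  have snd_w: "snd w" using w adj_snd[OF w(1)] u by simp
  \<comment> \<open>Every tagged vertex of the cycle starts a longest path, so none is adjacent to
    the outside vertex \<open>w\<close>. Hence the neighbours of \<open>w\<close> at cycle vertices
    all have flipped tags, and there are at most \<open>t < d\<close> of these.\<close>
  obtain x where x: "adj w x" "fst x \<notin> fst ` ?M"
  proof (rule ccontr)
    assume "\<not> thesis"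
    then have inM: "\<And>x. adj w x \<Longrightarrow> fst x \<in> fst ` ?M" using that by blast
    have "{x. adj w x} \<subseteq> flip ` ?N"
    proof
      fix x assume "x \<in> {x. adj w x}"
      then have wx: "adj w x" by simp
      then obtain m where m: "m \<in> ?M" "fst x = fst m" using inM by blast
      have "x \<noteq> m"
      proof
        assume "x = m"
        then obtain r where "path r" "length r = L" "set r = ?M" "hd r = x"
          using m cycle_subset_ends[OF c] endsE by blast
        then show False using hd_nbrs_fst[of r w] wx adj_sym w(2) by auto
      qed
      then have "x = flip m" using eq_or_eq_flip m by blast
      moreover from this have "snd m" using adj_snd[OF wx] snd_w by simp
      ultimately show "x \<in> flip ` ?N" using m by blast
    qed
    then have "card {x. adj w x} \<le> card (flip ` ?N)" by (intro card_mono) auto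
    also have "\<dots> \<le> t" using card_image_le[of ?N flip] N by simp
    finally show False using adj_degree[OF w(1)] t by simp
  qed
  have "path (x # w # flip u # ?p)"
  proof -
    have "successively adj (flip u # ?p)"
      using succ_p hd_p adj_sym[OF u(3)] by (simp only: successively_Cons) simp
    then have "successively adj (x # w # flip u # ?p)"
      using x w adj_sym by simp
    moreover have "fst x \<noteq> fst w" using adj_fst_neq[OF x(1)] by simp
    moreover have "fst x \<notin> fst ` set (flip u # ?p)" "fst w \<notin> fst ` set (flip u # ?p)"
      using x(2) w(2) sub_p u(2) by auto
    ultimately show ?thesis using dist by (auto simp: path_def)
  qed
  moreover have "length ?p + 2 = L"
    using q(3) c(2) by (simp add: split bs)
  ultimately show False using path_length_le by fastforce
qed

section \<open>Longest paths with an odd number of vertices\<close>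

text \<open>
  The set \<open>X\<close> below consists of the ends whose removal leaves a Hamiltonian cycle. A flipped
  element of \<open>X\<close> with a neighbour \<open>y\<close> in \<open>set p\<close> would be joined to the path that runs round the
  cycle from \<open>y\<close>, and to a vertex outside; hence \<open>X\<close> receives no flip arcs. On the other hand,
  many rotations at both ends of a path produce many elements of \<open>X\<close>.
\<close>

lemma odd_impossible:
  assumes p: "path p" "length p = L" and t: "L = 2 * t + 1" "4 * t + 1 \<le> 3 * d"
  shows False
proof -
  define M where "M = set p"
  define s where "s = snd (hd p)"
  define N where "N = {g \<in> M. snd g = s}"
  define X where "X = {x \<in> ends M. \<exists>c. cycle c \<and> set c = M - {x}}"
  have finM: "finite M" by (simp add: M_def)
  have cardN: "card N = t + 1"
    using path_sign_card_odd[OF p(1), of t s] p t by (simp add: N_def M_def s_def)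
  have finN: "finite N" using finM by (simp add: N_def)
  \<comment> \<open>With an odd number of vertices the first vertex always lies in the larger tag
    class, which is \<open>N\<close> for every path on \<open>M\<close>.\<close>
  have hd_sign: "snd (hd q) = s" if "path q" "length q = L" "set q = M" for q
    using path_sign_card_odd[OF that(1), of t s] that t cardN by (auto simp: N_def split: if_splits)
  have ends_N: "ends M \<subseteq> N"
  proof
    fix h assume "h \<in> ends M"
    then obtain q where "path q" "length q = L" "set q = M" "hd q = h" "q \<noteq> []" by (rule endsE)
    then show "h \<in> N" using hd_sign[of q] hd_in_set[of q] by (simp add: N_def)
  qed
  have hd_end: "hd q \<in> ends M" if "path q" "length q = L" "set q = M" for q
    using that unfolding ends_def by blast
  have last_end: "last q \<in> ends M" if "path q" "length q = L" "set q = M" for q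
    using hd_end[of "rev q"] that by (simp add: hd_rev)
  have rot: "rotation_ends q \<subseteq> ends M" "rotation_ends q \<subseteq> N"
    if "path q" "length q = L" "set q = M" for q
    using rotation_ends_subset_ends[of q] that ends_N by auto
  have X: "X \<subseteq> N" "finite X"
    using ends_N finN by (auto simp: X_def intro: finite_subset)
  have no_arc: "\<not> adj y (flip x)" if x: "x \<in> X" and y: "y \<in> M" for x y
  proof
    assume yx: "adj y (flip x)"
    obtain c where c: "cycle c" "set c = M - {x}" and "x \<in> ends M"
      using x by (auto simp: X_def)
    from \<open>x \<in> ends M\<close> obtain q where q: "path q" "length q = L" "set q = M" "hd q = x" "q \<noteq> []"
      by (rule endsE)
    have "y \<noteq> x" using adj_fst_neq[OF yx] by auto
    then have "y \<in> set c" using c y by simp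
    with c(1) obtain r where r: "cycle r" "set r = set c" "hd r = y" by (rule cycle_rotate)
    have path_r: "path r" "r \<noteq> []" using r by (auto simp: cycle_def)
    have "L \<le> 2 * d" using t by simp
    then obtain w where w: "adj w (flip x)" "fst w \<notin> fst ` M"
      using flip_hd_nbr_outside[of q y] q yx by metis
    have xM: "x \<in> M" using q hd_in_set by blast
    have "fst x \<notin> fst ` set r"
    proof
      assume "fst x \<in> fst ` set r"
      then obtain z where "z \<in> M" "z \<noteq> x" "fst x = fst z" using r c by auto
      then show False using path_inj_on_fst[OF q(1)] q(3) xM by (auto simp: inj_on_def)
    qed
    moreover have "fst w \<notin> fst ` set r" "fst w \<noteq> fst x" using w r c xM by auto
    ultimately have "path (w # flip x # r)"
      using path_r r w adj_sym[OF yx] by (auto simp: path_def successively_Cons)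
    moreover have "length r = 2 * t"
      using path_card[OF path_r(1)] r c xM finM path_card[OF q(1)] q t by simp
    ultimately show False using path_length_le t by fastforce
  qed
  have flip_sub: "flip_nbrs_in M y \<subseteq> N - X" if "y \<in> N" for y
  proof
    fix z assume z: "z \<in> flip_nbrs_in M y"
    then have "snd z = s" using flip_nbr_sign that by (auto simp: N_def)
    then show "z \<in> N - X" using z that no_arc[of z y] by (auto simp: flip_nbrs_in_def N_def)
  qed
  \<comment> \<open>At such a \<open>u\<close>, the first vertex is adjacent to the successor of
    \<open>u\<close> and the last one to its predecessor, so the two pieces around \<open>u\<close>
    close up to a cycle avoiding \<open>u\<close>.\<close>
  have rot_inter: "rotation_ends q \<inter> rotation_ends (rev q) \<subseteq> X - {last q}"
    if q: "path q" "length q = L" "set q = M" for q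
  proof
    fix u assume u: "u \<in> rotation_ends q \<inter> rotation_ends (rev q)"
    obtain as g bs where split: "q = as @ u # g # bs" and g: "adj (hd q) g"
      using u by (auto elim: rotation_endsE)
    obtain as' g' bs' where split': "rev q = as' @ u # g' # bs'" and g': "adj (hd (rev q)) g'"
      using u by (auto elim: rotation_endsE)
    have dist: "u \<notin> set as" "u \<notin> set (g # bs)"
      using path_distinct[OF q(1)] by (auto simp: split)
    have "q = (rev bs' @ [g']) @ u # rev as'"
      using arg_cong[OF split', of rev] by simp
    then have "as @ u # g # bs = (rev bs' @ [g']) @ u # rev as'" using split by simp
    then have as: "as = rev bs' @ [g']"
      using dist append_Cons_eq_iff[of u as "g # bs"] by blast
    have last_q: "last (g # bs) = last q" by (simp add: split)
    have hd_q: "hd as = hd q" by (simp add: split as hd_append)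
    let ?c = "as @ rev (g # bs)"
    have "successively adj as" "successively adj (rev (g # bs))"
      using q(1) unfolding successively_adj_rev
      by (auto simp: split path_def successively_append_iff successively_Cons)
    moreover have "adj (last as) (hd (rev (g # bs)))"
      using adj_sym[OF g'] last_q by (simp only: hd_rev) (simp add: as)
    ultimately have "successively adj ?c" by (simp only: successively_append_iff) simp
    moreover have "distinct (map fst ?c)"
      using q(1) by (auto simp: split path_def rev_map[symmetric])
    moreover have "adj (last ?c) (hd ?c)" using adj_sym[OF g] hd_q
      by (auto simp: as hd_append split: if_splits)
    ultimately have "cycle ?c" by (simp add: cycle_def path_def)
    moreover have "set ?c = M - {u}" using q(3) dist by (auto simp: split)
    moreover have "u \<in> ends M" using u rot(1)[OF q] by blast
    ultimately have "u \<in> X" unfolding X_def by blast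
    moreover have "u \<noteq> last q" using last_notin_rotation_ends[OF q(1)] u by blast
    ultimately show "u \<in> X - {last q}" by blast
  qed
  have rot_sum: "card (nbrs_in M (hd q)) + card (nbrs_in M (last q)) \<le> t + 1 + card (X - {last q})"
    if q: "path q" "length q = L" "set q = M" for q
  proof -
    let ?E = "rotation_ends q" and ?F = "rotation_ends (rev q)"
    have sub: "?E \<subseteq> N" "?F \<subseteq> N" using rot(2)[OF q] rot(2)[of "rev q"] q by auto
    then have fin: "finite ?E" "finite ?F" using finN by (auto intro: finite_subset)
    have "card ?E + card ?F = card (?E \<union> ?F) + card (?E \<inter> ?F)"
      using fin by (rule card_Un_Int)
    also have "\<dots> \<le> card N + card (X - {last q})"
      using sub finN X rot_inter[OF q] by (intro add_mono card_mono) auto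
    finally show ?thesis
      using card_rotation_ends[of q] card_rotation_ends[of "rev q"] q cardN by (simp add: hd_rev)
  qed
  show False
  proof (cases "X = {}")
    case True
    have "hd p \<in> ends M" using hd_end p by (simp add: M_def)
    then have "\<exists>h. h \<in> ends M \<and> (\<forall>y. y \<in> ends M \<longrightarrow> card (nbrs_in M y) \<le> card (nbrs_in M h))"
      using card_nbrs_in_le[OF finM]
      by (intro ex_has_greatest_nat[where b = "Suc (card M)"]) (auto simp: less_Suc_eq_le)
    then obtain h where h: "h \<in> ends M"
      and max: "\<And>y. y \<in> ends M \<Longrightarrow> card (nbrs_in M y) \<le> card (nbrs_in M h)" by blast
    \<comment> \<open>The maximum is taken in two stages: \<open>h\<close> is best among all ends,
      then the other end is best among paths starting at \<open>h\<close>.\<close>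
    from h obtain q0 where q0: "path q0" "length q0 = L" "set q0 = M" "hd q0 = h" by (rule endsE)
    let ?P = "\<lambda>q. path q \<and> length q = L \<and> set q = M \<and> hd q = h"
    have "\<exists>q. ?P q \<and> (\<forall>r. ?P r \<longrightarrow> card (nbrs_in M (last r)) \<le> card (nbrs_in M (last q)))"
      using q0 card_nbrs_in_le[OF finM]
      by (intro ex_has_greatest_nat[where b = "Suc (card M)" and k = q0]) (auto simp: less_Suc_eq_le)
    then obtain q where q: "path q" "length q = L" "set q = M" "hd q = h"
      and maxq: "\<And>r. path r \<Longrightarrow> length r = L \<Longrightarrow> set r = M \<Longrightarrow> hd r = h \<Longrightarrow>
        card (nbrs_in M (last r)) \<le> card (nbrs_in M (last q))" by blast
    define a where "a = card (nbrs_in M h)"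
    define b where "b = card (nbrs_in M (last q))"
    have ba: "b \<le> a" using max last_end[OF q(1-3)] by (simp add: a_def b_def)
    have "card (nbrs_in M (hd r)) \<le> b" if "path r" "length r = L" "set r = M" "last r = h" for r
      using maxq[of "rev r"] that by (simp add: hd_rev last_rev b_def)
    then have b_ge: "2 * d + 1 \<le> b + 2 * (t + 1)"
      using rotation_bound[of "rev q"] q hd_sign[of "rev q"] cardN
      by (simp add: hd_rev last_rev b_def N_def)
    \<comment> \<open>The last vertex is an end in the same class but never a rotation end; adding
      it gains one in the size of \<open>?H\<close>.\<close>
    let ?H = "insert (last q) (rotation_ends q)"
    have H: "?H \<subseteq> ends M" "?H \<subseteq> {g \<in> M. snd g = s}" "?H \<noteq> {}"
      using rot[OF q(1-3)] last_end[OF q(1-3)] ends_N by (auto simp: N_def)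
    have "finite ?H" using finite_subset[OF H(2)] finM by simp
    then have cardH: "card ?H = a + 1"
      using last_notin_rotation_ends[OF q(1)] card_rotation_ends[OF q(1)] q by (simp add: a_def)
    have "y \<in> ?H \<Longrightarrow> card (nbrs_in M y) \<le> a" for y
      using max[of y] H(1) unfolding a_def by blast
    note bound = ends_degree_bound[OF finM H, of "{}", OF _ _ _ this, simplified]
    have a_ge: "2 * d \<le> a + 2 * t"
      using bound(1) cardH cardN by (simp add: N_def)
    \<comment> \<open>For \<open>b < a\<close> the last vertex makes the bound strict; for
      \<open>b = a\<close> the bound \<open>a_ge\<close> serves both ends. Either way
      \<open>4 * d \<le> 4 * t + a + b\<close>.\<close>
    have "2 * d + 1 \<le> a + 2 * t" if "b < a"
      using that bound(2)[of "last q"] cardH cardN by (simp add: N_def b_def)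
    then have "b = a \<or> 2 * d + 1 \<le> a + 2 * t" using ba by linarith
    moreover have "a + b \<le> t + 1" using rot_sum[OF q(1-3)] q True by (simp add: a_def b_def)
    ultimately have "4 * d \<le> 5 * t + 1" using a_ge b_ge by auto
    then show False using t(2) by linarith
  next
    case False
    then obtain x where x: "x \<in> X" by blast
    then have "x \<in> ends M" by (simp add: X_def)
    then obtain q1 where q1: "path q1" "length q1 = L" "set q1 = M" "hd q1 = x" by (rule endsE)
    let ?P = "\<lambda>q. path q \<and> length q = L \<and> set q = M \<and> last q = x"
    have "\<exists>q. ?P q \<and> (\<forall>r. ?P r \<longrightarrow> card (nbrs_in M (hd r)) \<le> card (nbrs_in M (hd q)))"
      using q1 card_nbrs_in_le[OF finM]
      by (intro ex_has_greatest_nat[where b = "Suc (card M)" and k = "rev q1"])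
        (auto simp: less_Suc_eq_le last_rev)
    then obtain q where q: "path q" "length q = L" "set q = M" "last q = x"
      and maxq: "\<And>r. path r \<Longrightarrow> length r = L \<Longrightarrow> set r = M \<Longrightarrow> last r = x \<Longrightarrow>
        card (nbrs_in M (hd r)) \<le> card (nbrs_in M (hd q))" by blast
    define a where "a = card (nbrs_in M (hd q))"
    define b where "b = card (nbrs_in M x)"
    let ?E = "rotation_ends q"
    have finE: "finite ?E" using rot(2)[OF q(1-3)] finN by (rule finite_subset)
    have cardE: "card ?E = a" using card_rotation_ends[OF q(1)] q by (simp add: a_def)
    have cardX: "card X \<le> t + 1" "card X \<ge> 1"
      using card_mono[OF finN X(1)] cardN x X by (auto simp: card_gt_0_iff Suc_le_eq)
    have deg: "d + card X \<le> card (nbrs_in M y) + (t + 1)" if y: "y \<in> ends M" for y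
    proof -
      have "card (flip_nbrs_in M y) \<le> card (N - X)"
        using flip_sub[of y] y ends_N finN by (intro card_mono) auto
      also have "\<dots> = t + 1 - card X" using X cardN by (simp add: card_Diff_subset)
      finally show ?thesis using ends_degree_le[OF y] cardX by simp
    qed
    have ab: "a + b \<le> t + card X"
      using rot_sum[OF q(1-3)] q x X cardX by (simp add: a_def b_def)
    have b_ge: "d + card X \<le> b + (t + 1)"
      using deg[OF \<open>x \<in> ends M\<close>] by (simp add: b_def)
    \<comment> \<open>Ending the path in an element of \<open>X\<close> ensures that the rotation
      ends miss at least one element of \<open>X\<close>.\<close>
    have "x \<notin> ?E" using last_notin_rotation_ends[OF q(1)] q by simp
    then have "card (?E \<inter> X) \<le> card (X - {x})" using X by (intro card_mono) auto
    then have g: "card (?E \<inter> X) + 1 \<le> card X" using x X cardX by simp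
    have E1: "card (?E - X) + card (?E \<inter> X) = a"
      using cardE card_Int_Diff[OF finE, of X] by simp
    have "?E - X \<noteq> {}"
    proof
      assume "?E - X = {}"
      then have "card (?E - X) = 0" by (simp only: card.empty)
      then have "a + 1 \<le> card X" using E1 g by linarith
      moreover have "d + card X \<le> a + (t + 1)" using deg hd_end[OF q(1-3)] by (simp add: a_def)
      ultimately show False using t by simp
    qed
    moreover have "card (nbrs_in M y) \<le> a" if "y \<in> ?E - X" for y
    proof -
      have "y \<in> ?E" using that by blast
      with q(1) obtain r where "path r" "set r = set q" "length r = length q" "hd r = y"
        "last r = last q" by (rule rotation_ends_path)
      then show ?thesis using maxq[of r] q by (simp add: a_def)
    qed
    moreover have "flip_nbrs_in M y \<inter> X = {}" if "y \<in> ?E - X" for y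
      using flip_sub[of y] rot(2)[OF q(1-3)] that by blast
    \<comment> \<open>Averaging is done over the rotation ends outside \<open>X\<close>, with
      \<open>Z = X\<close> since no flipped neighbour lies in \<open>X\<close>.\<close>
    ultimately have "2 * d + 2 * card X + card (?E - X) + 1 \<le> 2 * a + 2 * card {g \<in> M. snd g = s}"
      using rot[OF q(1-3)] X finM by (intro ends_degree_bound(1)) (auto simp: N_def)
    then have "2 * d + 2 * card X + card (?E - X) + 1 \<le> 2 * a + 2 * t + 2"
      using cardN by (simp add: N_def)
    then have "2 * d + 1 \<le> a + 2 * t" using E1 g cardX(2) by linarith
    \<comment> \<open>The size of \<open>X\<close> cancels here; the lower and upper bounds on
      \<open>a\<close> then give \<open>3 * d \<le> 4 * t\<close>.\<close>
    moreover have "a + d \<le> 2 * t + 1" using ab b_ge by linarith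
    ultimately show False using t(2) by linarith
  qed
qed

end

section \<open>From oriented graphs to tagged vertices and back\<close>

definition role_adj :: "('a, 'b) pre_digraph \<Rightarrow> 'a \<times> bool \<Rightarrow> 'a \<times> bool \<Rightarrow> bool" where
  "role_adj G g h \<longleftrightarrow>
     (if snd g then \<not> snd h \<and> fst g \<rightarrow>\<^bsub>G\<^esub> fst h else snd h \<and> fst h \<rightarrow>\<^bsub>G\<^esub> fst g)"

context digraph
begin

lemma card_out_nbrs: "card {w. v \<rightarrow> w} = out_degree G v"
proof -
  have "{w. v \<rightarrow> w} = head G ` out_arcs G v"
    by (auto simp: arcs_ends_def arc_to_ends_def image_iff)
  moreover have "inj_on (head G) (out_arcs G v)"
    using no_multi_arcs by (auto simp: inj_on_def arc_to_ends_def)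
  ultimately show ?thesis by (simp add: out_degree_def card_image)
qed

lemma card_in_nbrs: "card {u. u \<rightarrow> v} = in_degree G v"
proof -
  have "{u. u \<rightarrow> v} = tail G ` in_arcs G v"
    by (auto simp: arcs_ends_def arc_to_ends_def image_iff)
  moreover have "inj_on (tail G) (in_arcs G v)"
    using no_multi_arcs by (auto simp: inj_on_def arc_to_ends_def)
  ultimately show ?thesis by (simp add: in_degree_def card_image)
qed

lemma finite_nbrs: "finite {w. v \<rightarrow> w}" "finite {u. u \<rightarrow> v}"
  by (auto intro!: finite_subset[OF _ finite_verts] dest: adj_in_verts)

lemma min_pseudo_semi_degree_le:
  assumes "u \<rightarrow> v"
  shows "min_pseudo_semi_degree G \<le> out_degree G u" "min_pseudo_semi_degree G \<le> in_degree G v"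
proof -
  have "out_degree G u > 0" "in_degree G v > 0"
    using assms finite_nbrs by (auto simp: card_gt_0_iff simp flip: card_out_nbrs card_in_nbrs)
  then have "out_degree G u \<in> positive_semi_degrees G" "in_degree G v \<in> positive_semi_degrees G"
    using adj_in_verts[OF assms] unfolding positive_semi_degrees_def by blast+
  moreover have "arcs G \<noteq> {}" using assms by (auto simp: arcs_ends_def)
  ultimately show "min_pseudo_semi_degree G \<le> out_degree G u" "min_pseudo_semi_degree G \<le> in_degree G v"
    using finite_positive_semi_degrees by (simp_all add: min_pseudo_semi_degree_def)
qed

lemma role_adj_verts: "role_adj G g h \<Longrightarrow> fst g \<in> verts G \<and> fst h \<in> verts G"
  by (auto simp: role_adj_def split: if_splits dest: adj_in_verts)

end

text \<open>The neighbours of a tagged vertex are the out-neighbours or the in-neighbours, according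
  to the tag. A single neighbour makes that degree positive, hence at least the
  pseudo-semi-degree.\<close>

lemma (in oriented_graph) signed_graph_role_adj:
  "signed_graph (role_adj G) (min_pseudo_semi_degree G)"
proof
  have nbrs: "{h. role_adj G g h} =
      (if snd g then (\<lambda>w. (w, False)) ` {w. fst g \<rightarrow> w} else (\<lambda>w. (w, True)) ` {w. w \<rightarrow> fst g})" for g
    by (auto simp: role_adj_def)
  show "finite {h. role_adj G g h}" for g
    using finite_nbrs by (simp add: nbrs)
  show "min_pseudo_semi_degree G \<le> card {h. role_adj G g h}" if "role_adj G g h" for g h
  proof (cases "snd g")
    case True
    then have "card {h. role_adj G g h} = out_degree G (fst g)"
      by (simp add: nbrs card_image inj_on_def card_out_nbrs)
    then show ?thesis
      using True that min_pseudo_semi_degree_le(1)[of "fst g" "fst h"] by (simp add: role_adj_def)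
  next
    case False
    then have "card {h. role_adj G g h} = in_degree G (fst g)"
      by (simp add: nbrs card_image inj_on_def card_in_nbrs)
    then show ?thesis
      using False that min_pseudo_semi_degree_le(2)[of "fst h" "fst g"] by (simp add: role_adj_def)
  qed
  show "\<not> role_adj G h (flip g)" if "role_adj G g (flip h)" for g h
    using that no_antiparallel by (auto simp: role_adj_def split: if_splits)
qed (auto simp: role_adj_def split: if_splits)

context oriented_graph
begin

interpretation roles: signed_graph "role_adj G" "min_pseudo_semi_degree G"
  by (rule signed_graph_role_adj)

lemma path_verts:
  assumes "roles.path p" "length p \<ge> 2"
  shows "fst ` set p \<subseteq> verts G"
proof
  fix v assume "v \<in> fst ` set p"
  then obtain i where i: "i < length p" "v = fst (p ! i)" by (auto simp: in_set_conv_nth)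
  have step: "role_adj G (p ! j) (p ! Suc j)" if "Suc j < length p" for j
    using assms(1) that by (simp add: roles.path_def successively_nth)
  show "v \<in> verts G"
  proof (cases i)
    case 0
    then show ?thesis using step[of 0] role_adj_verts assms(2) i by auto
  next
    case (Suc j)
    then show ?thesis using step[of j] role_adj_verts i by auto
  qed
qed

lemma antidirected_path_of_path:
  assumes "roles.path p" "length p = l + 1" "l \<ge> 1"
  shows "antidirected_path G l (map fst p)"
proof -
  \<comment> \<open>Tags alternate, so the dominating vertices occupy the even positions exactly if
    the first tag is \<open>True\<close>.\<close>
  let ?r = "if snd (hd p) then 0 else 1 :: nat"
  have "if i mod 2 = ?r then map fst p ! i \<rightarrow> map fst p ! (i + 1)
      else map fst p ! (i + 1) \<rightarrow> map fst p ! i" if "i < l" for i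
  proof -
    have "role_adj G (p ! i) (p ! Suc i)"
      using assms that by (simp add: roles.path_def successively_nth)
    moreover have "i mod 2 = ?r \<longleftrightarrow> snd (p ! i)"
      using roles.path_snd_nth[OF assms(1), of i] assms(2) that by (simp, presburger)
    ultimately show ?thesis using assms(2) that by (simp add: role_adj_def split: if_splits)
  qed
  moreover have "?r \<in> {0, 1}" by simp
  moreover have "distinct (map fst p)" using assms(1) by (simp add: roles.path_def)
  moreover have "set (map fst p) \<subseteq> verts G" using path_verts assms by simp
  ultimately show ?thesis using assms(2) unfolding antidirected_path_def by fastforce
qed

lemma antidirected_cycle_of_cycle:
  assumes "roles.cycle c" "length c = l" "even l" "l \<ge> 3"
  shows "antidirected_cycle G l (map fst c)"
proof -
  have path: "roles.path c" and ne: "c \<noteq> []" using assms by (auto simp: roles.cycle_def)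
  have next_adj: "role_adj G (c ! i) (c ! ((i + 1) mod l))" if "i < l" for i
  proof (cases "i + 1 < l")
    case True
    then show ?thesis using path assms(2) by (simp add: roles.path_def successively_nth)
  next
    case False
    then have "i = l - 1" "i + 1 = l" using that by auto
    then show ?thesis
      using assms(1,2) ne by (simp add: roles.cycle_def last_conv_nth hd_conv_nth)
  qed
  let ?r = "if snd (hd c) then 0 else 1 :: nat"
  have arcs: "map fst c ! i \<rightarrow> map fst c ! ((i + 1) mod l) \<and>
      map fst c ! i \<rightarrow> map fst c ! ((i + l - 1) mod l)" if i: "i < l" "i mod 2 = ?r" for i
  proof -
    \<comment> \<open>\<open>?j\<close> is the cyclic predecessor of \<open>i\<close>; its adjacency
      to the next vertex, read backwards, gives the second arc at \<open>i\<close>.\<close>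
    let ?j = "(i + l - 1) mod l"
    have "snd (c ! i)"
      using roles.path_snd_nth[OF path, of i] assms(2) i by (simp split: if_splits; presburger)
    moreover have j: "?j < l" "(i + 1) mod l < l" using assms(4) by auto
    moreover have "(?j + 1) mod l = (i + l - 1 + 1) mod l" by (rule mod_add_left_eq)
    then have "(?j + 1) mod l = i" using i by simp
    then have "role_adj G (c ! ?j) (c ! i)" using next_adj[OF j(1)] by simp
    then have "role_adj G (c ! i) (c ! ?j)" by (rule roles.adj_sym)
    ultimately show ?thesis
      using next_adj[OF i(1)] i(1) assms(2) by (simp add: role_adj_def)
  qed
  have "\<exists>r\<in>{0, 1}. \<forall>i<l. i mod 2 = r \<longrightarrow> map fst c ! i \<rightarrow> map fst c ! ((i + 1) mod l) \<and>
      map fst c ! i \<rightarrow> map fst c ! ((i + l - 1) mod l)"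
    using arcs by (intro bexI[of _ ?r]) auto
  moreover have "distinct (map fst c)" using path by (simp add: roles.path_def)
  moreover have "set (map fst c) \<subseteq> verts G" using path_verts path assms by simp
  ultimately show ?thesis using assms unfolding antidirected_cycle_def by simp
qed

lemma antidirected_path_or_cycle:
  assumes k: "k \<ge> 2" "2 * k + 1 \<le> 3 * min_pseudo_semi_degree G"
  shows "(\<exists>l p. l \<ge> k + 1 \<and> antidirected_path G l p) \<or>
         (\<exists>l c. l \<ge> k + 1 \<and> antidirected_cycle G l c)"
proof (rule ccontr)
  let ?d = "min_pseudo_semi_degree G"
  assume neg: "\<not> ?thesis"
  \<comment> \<open>A path with \<open>k + 2\<close> vertices would already have length
    \<open>k + 1\<close>.\<close>
  have len: "length p \<le> k + 1" if "roles.path p" for p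
  proof (rule ccontr)
    assume "\<not> length p \<le> k + 1"
    then have "antidirected_path G (length p - 1) (map fst p)" "length p - 1 \<ge> k + 1"
      using that by (auto intro!: antidirected_path_of_path)
    then show False using neg by blast
  qed
  have "\<exists>p. roles.path p \<and> (\<forall>q. roles.path q \<longrightarrow> length q \<le> length p)"
    using len by (intro ex_has_greatest_nat[where b = "k + 2" and k = "[]"])
      (auto simp: roles.path_def less_Suc_eq_le)
  then obtain p where p: "roles.path p" and max: "\<And>q. roles.path q \<Longrightarrow> length q \<le> length p" by blast
  define L where "L = length p"
  have "arcs G \<noteq> {}" using k by (auto simp: min_pseudo_semi_degree_def)
  then obtain e where e: "e \<in> arcs G" by blast
  have "tail G e \<noteq> head G e" using no_loops e by blast
  then have "roles.path [(tail G e, True), (head G e, False)]"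
    using e by (auto simp: roles.path_def role_adj_def arcs_ends_def arc_to_ends_def)
  then have "2 \<le> L" using max by (fastforce simp: L_def)
  then interpret bounded_signed_graph "role_adj G" ?d L
    using max by unfold_locales (auto simp: L_def)
  have Lk: "L \<le> k + 1" using len p by (simp add: L_def)
  show False
  proof (cases "even L")
    case True
    then obtain t where t: "L = 2 * t" by blast
    have "4 * t \<le> 3 * ?d + 1" using t Lk k by simp
    then obtain c where c: "roles.cycle c" "set c = set p"
      using even_hamiltonian_cycle[OF p] t L_def by metis
    then have len_c: "length c = L"
      using roles.path_card[of c] roles.path_card[OF p] by (simp add: roles.cycle_def L_def)
    show False
    proof (cases "L = k + 1")
      case True
      then have "antidirected_cycle G L (map fst c)"
        using c len_c \<open>even L\<close> k by (intro antidirected_cycle_of_cycle) auto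
      then show False using neg True by blast
    next
      case False
      \<comment> \<open>Since now \<open>2 * t \<le> k\<close>, the stronger degree condition holds,
        which may fail for \<open>L = k + 1\<close>.\<close>
      then have "4 * t + 1 \<le> 3 * ?d" using t Lk k by simp
      then show False using even_cycle_impossible c len_c t by blast
    qed
  next
    case False
    then obtain t where t: "L = 2 * t + 1" by (elim oddE)
    then have "4 * t + 1 \<le> 3 * ?d" using Lk k by simp
    then show False using odd_impossible p t L_def by metis
  qed
qed

end

theorem theorem1p4:
  fixes D :: "('a, 'b) pre_digraph" and k :: nat
  assumes "k \<ge> 2"
    and "oriented_graph D"
    and "real (min_pseudo_semi_degree D) \<ge> (2 * real k + 1) / 3"
  shows "(\<exists>l p. l \<ge> k + 1 \<and> antidirected_path D l p) \<or>
         (\<exists>l c. l \<ge> k + 1 \<and> antidirected_cycle D l c)"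
proof -
  interpret oriented_graph D by fact
  have "2 * k + 1 \<le> 3 * min_pseudo_semi_degree D" using assms(3) by (simp add: field_simps flip: of_nat_le_iff)
  then show ?thesis using assms(1) by (intro antidirected_path_or_cycle)
qed

end
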